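(* Let $\sigma\ge 0.5$. The solution of the homogeneous explicit-implicit scheme $$\frac{y^{n+1}-y^n}\tau+C^ny^n+D(\sigma y^{n+1}+(1-\sigma)y^n)=0,\qquad n=0,1,\dots,N_0-1,$$ satisfies the estimate $$\|y^{n+1}\|_D\le\varrho\|y^n\|_D,\qquad \varrho=1+\frac{M_2}4\tau ,\qquad n=0,1,\dots,N_0-1.$$
   Context: $H$ is a finite-dimensional real Hilbert space (of grid functions) with scalar product $(\cdot,\cdot)$ and norm $\|\cdot\|$. $\tau>0$ is the time step, $N_0\tau=T$. $D$ is a time-independent linear operator with $D=D^*\ge\frac{\kappa_1}{M_0}E$, $\kappa_1,M_0>0$, $E$ the identity, and $\|y\|_D=(Dy,y)^{1/2}$. $C^n$ is a (possibly time-dependent) linear operator on $H$ (discrete convection operator in nondivergent, divergent or skew-symmetric form) satisfying $\|C^ny\|^2\le M_2(Dy,y)$ for all $y\in H$, with a positive constant $M_2$ independent of $n$. *)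

theory Defs
  imports "HOL-Analysis.Analysis"
begin

text \<open>The order on operators of a real inner product space given by their quadratic forms.
  It is only meant for self-adjoint operators.\<close>

definition op_le :: "('a::real_inner \<Rightarrow> 'a) \<Rightarrow> ('a \<Rightarrow> 'a) \<Rightarrow> bool" where
  "op_le A B \<longleftrightarrow> (\<forall>y. A y \<bullet> y \<le> B y \<bullet> y)"

definition energy_norm :: "('a::real_inner \<Rightarrow> 'a) \<Rightarrow> 'a \<Rightarrow> real" where
  "energy_norm D y = sqrt (D y \<bullet> y)"

text \<open>Only the levels \<open>y 0, \<dots>, y N\<close> are constrained.\<close>

definition explicit_implicit_solution ::
  "real \<Rightarrow> real \<Rightarrow> nat \<Rightarrow> (nat \<Rightarrow> 'a \<Rightarrow> 'a) \<Rightarrow> ('a \<Rightarrow> 'a) \<Rightarrow> (nat \<Rightarrow> 'a::real_inner) \<Rightarrow> bool"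
where
  "explicit_implicit_solution \<sigma> \<tau> N C D y \<longleftrightarrow>
     (\<forall>n<N. (y (n + 1) - y n) /\<^sub>R \<tau> + C n (y n)
              + D (\<sigma> *\<^sub>R y (n + 1) + (1 - \<sigma>) *\<^sub>R y n) = 0)"

end

theory Submission
  imports Defs
begin

text \<open>Testing one step of the scheme with \<open>2 \<tau> w\<close>, where \<open>w = (y\<^sup>n\<^sup>+\<^sup>1 - y\<^sup>n) / \<tau>\<close>, gives by
  self-adjointness of \<open>D\<close> the energy balance
  \<open>\<parallel>y\<^sup>n\<^sup>+\<^sup>1\<parallel>\<^sub>D\<^sup>2 = \<parallel>y\<^sup>n\<parallel>\<^sub>D\<^sup>2 - 2 \<tau> (\<parallel>w\<parallel>\<^sup>2 + (C\<^sup>n y\<^sup>n, w)) - (2 \<sigma> - 1) \<tau>\<^sup>2 (D w, w)\<close>.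
  For \<open>\<sigma> \<ge> 1/2\<close> the last term is nonpositive, and completing the square bounds the middle one
  by \<open>\<tau>/2\<close> times the squared norm of the convection term, hence by \<open>M\<^sub>2 \<tau>/2\<close> times the energy.
  Finally \<open>1 + M\<^sub>2 \<tau>/2 \<le> (1 + M\<^sub>2 \<tau>/4)\<^sup>2\<close>.\<close>

text \<open>Written in \<open>u\<close> and the difference quotient \<open>w\<close>, the balance is
  a polynomial identity with no division by \<open>\<tau>\<close>.\<close>

lemma energy_balance:
  fixes D :: "'a::real_inner \<Rightarrow> 'a"
  assumes "linear D" and sym: "\<And>x z. D x \<bullet> z = x \<bullet> D z"
    and step: "w + c + D (\<sigma> *\<^sub>R (u + \<tau> *\<^sub>R w) + (1 - \<sigma>) *\<^sub>R u) = 0"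
  shows "D (u + \<tau> *\<^sub>R w) \<bullet> (u + \<tau> *\<^sub>R w) =
    D u \<bullet> u - 2 * \<tau> * (w \<bullet> w + c \<bullet> w) - (2 * \<sigma> - 1) * \<tau>\<^sup>2 * (D w \<bullet> w)"
proof -
  interpret linear D by fact
  have "\<sigma> *\<^sub>R (u + \<tau> *\<^sub>R w) + (1 - \<sigma>) *\<^sub>R u = u + (\<sigma> * \<tau>) *\<^sub>R w"
    by (simp add: algebra_simps)
  with step have "w + c + D u + (\<sigma> * \<tau>) *\<^sub>R D w = 0"
    by (simp add: add scale add.assoc)
  then have "(w + c + D u + (\<sigma> * \<tau>) *\<^sub>R D w) \<bullet> w = 0"
    by simp
  then have test: "D u \<bullet> w = - (w \<bullet> w + c \<bullet> w) - \<sigma> * \<tau> * (D w \<bullet> w)"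
    by (simp add: inner_add_left)
  \<comment> \<open>Self-adjointness merges the two mixed terms of the expanded energy into the one
    that \<open>test\<close> evaluates.\<close>
  have "D w \<bullet> u = D u \<bullet> w"
    by (metis sym inner_commute)
  then have "D (u + \<tau> *\<^sub>R w) \<bullet> (u + \<tau> *\<^sub>R w) = D u \<bullet> u + 2 * \<tau> * (D u \<bullet> w) + \<tau>\<^sup>2 * (D w \<bullet> w)"
    by (simp add: add scale inner_add_left inner_add_right power2_eq_square algebra_simps)
  \<comment> \<open>The weight \<open>\<sigma>\<close> contributes
    \<open>- 2 * \<sigma> * \<tau>\<^sup>2\<close> against \<open>\<tau>\<^sup>2\<close> from the
    expansion, hence the threshold 1/2.\<close>
  then show ?thesis
    unfolding test by (simp add: power2_eq_square algebra_simps)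
qed

text \<open>The convection term is frozen as a vector \<open>c\<close>, so its dependence on time
  does not enter.\<close>

lemma energy_norm_step_le:
  fixes D :: "'a::real_inner \<Rightarrow> 'a"
  assumes "linear D" and "\<And>x z. D x \<bullet> z = x \<bullet> D z" and pos: "\<And>x. D x \<bullet> x \<ge> 0"
    and "\<tau> > 0" and "M \<ge> 0" and "\<sigma> \<ge> 1/2"
    and c: "(norm c)\<^sup>2 \<le> M * (D u \<bullet> u)"
    and step: "(v - u) /\<^sub>R \<tau> + c + D (\<sigma> *\<^sub>R v + (1 - \<sigma>) *\<^sub>R u) = 0"
  shows "energy_norm D v \<le> (1 + M / 4 * \<tau>) * energy_norm D u"
proof -
  define w where "w = (v - u) /\<^sub>R \<tau>"
  have v: "v = u + \<tau> *\<^sub>R w"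
    using \<open>\<tau> > 0\<close> by (simp add: w_def)
  have "D v \<bullet> v = D u \<bullet> u - 2 * \<tau> * (w \<bullet> w + c \<bullet> w) - (2 * \<sigma> - 1) * \<tau>\<^sup>2 * (D w \<bullet> w)"
    unfolding v using assms(1,2) step[folded w_def, unfolded v] by (rule energy_balance)
  moreover have "(2 * \<sigma> - 1) * \<tau>\<^sup>2 * (D w \<bullet> w) \<ge> 0"
    using \<open>\<sigma> \<ge> 1/2\<close> pos by simp
  moreover have "- (w \<bullet> w + c \<bullet> w) \<le> (norm c)\<^sup>2 / 4"
  proof -
    \<comment> \<open>The shift by half of \<open>c\<close> makes the mixed term exactly
      \<open>c \<bullet> w\<close>.\<close>
    have "0 \<le> (w + c /\<^sub>R 2) \<bullet> (w + c /\<^sub>R 2)"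
      by simp
    also have "\<dots> = w \<bullet> w + c \<bullet> w + (norm c)\<^sup>2 / 4"
      by (simp add: inner_add_left inner_add_right inner_commute power2_norm_eq_inner)
    finally show ?thesis
      by simp
  qed
  then have "2 * \<tau> * - (w \<bullet> w + c \<bullet> w) \<le> 2 * \<tau> * (M * (D u \<bullet> u) / 4)"
    using c \<open>\<tau> > 0\<close> by (intro mult_left_mono) auto
  ultimately have "D v \<bullet> v \<le> (1 + M * \<tau> / 2) * (D u \<bullet> u)"
    by (simp add: algebra_simps)
  \<comment> \<open>The factors differ by the square of \<open>M / 4 * \<tau>\<close>; a perfect
    square leaves the plain factor after the root.\<close>
  also have "\<dots> \<le> (1 + M / 4 * \<tau>)\<^sup>2 * (D u \<bullet> u)"
    using pos by (intro mult_right_mono) (auto simp: power2_sum power_mult_distrib)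
  finally have "sqrt (D v \<bullet> v) \<le> sqrt ((1 + M / 4 * \<tau>)\<^sup>2 * (D u \<bullet> u))"
    by simp
  then show ?thesis
    using \<open>\<tau> > 0\<close> \<open>M \<ge> 0\<close> by (simp add: energy_norm_def real_sqrt_mult)
qed

theorem theorem19:
  fixes C :: "nat \<Rightarrow> 'a::euclidean_space \<Rightarrow> 'a"
    and D :: "'a \<Rightarrow> 'a"
    and y :: "nat \<Rightarrow> 'a"
    and \<sigma> \<tau> T \<kappa>\<^sub>1 M\<^sub>0 M\<^sub>2 :: real
    and N\<^sub>0 :: nat
  assumes "\<tau> > 0" and "real N\<^sub>0 * \<tau> = T"
    and "\<kappa>\<^sub>1 > 0" and "M\<^sub>0 > 0" and "M\<^sub>2 > 0"
    and "linear D" and "adjoint D = D"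
    and "op_le (\<lambda>v. (\<kappa>\<^sub>1 / M\<^sub>0) *\<^sub>R v) D"
    and "\<And>n. n < N\<^sub>0 \<Longrightarrow> linear (C n)"
    and "\<And>n v. n < N\<^sub>0 \<Longrightarrow> (norm (C n v))\<^sup>2 \<le> M\<^sub>2 * (D v \<bullet> v)"
    and "\<sigma> \<ge> 0.5"
    and "explicit_implicit_solution \<sigma> \<tau> N\<^sub>0 C D y"
  shows "\<forall>n<N\<^sub>0. energy_norm D (y (n + 1)) \<le> (1 + M\<^sub>2 / 4 * \<tau>) * energy_norm D (y n)"
proof (intro allI impI)
  fix n assume "n < N\<^sub>0"
  show "energy_norm D (y (n + 1)) \<le> (1 + M\<^sub>2 / 4 * \<tau>) * energy_norm D (y n)"
  proof (rule energy_norm_step_le)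
    show "D x \<bullet> z = x \<bullet> D z" for x z
      using adjoint_works[OF \<open>linear D\<close>] \<open>adjoint D = D\<close> by metis
    \<comment> \<open>The lower bound of \<open>D\<close> by a positive multiple of the identity
      gives this.\<close>
    show "D x \<bullet> x \<ge> 0" for x
    proof -
      have "0 \<le> (\<kappa>\<^sub>1 / M\<^sub>0) *\<^sub>R x \<bullet> x"
        using \<open>\<kappa>\<^sub>1 > 0\<close> \<open>M\<^sub>0 > 0\<close> by simp
      also have "\<dots> \<le> D x \<bullet> x"
        using assms(8) by (simp add: op_le_def)
      finally show ?thesis .
    qed
    show "(y (n + 1) - y n) /\<^sub>R \<tau> + C n (y n) + D (\<sigma> *\<^sub>R y (n + 1) + (1 - \<sigma>) *\<^sub>R y n) = 0"
      using assms(12) \<open>n < N\<^sub>0\<close> by (simp add: explicit_implicit_solution_def)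
  qed (use assms \<open>n < N\<^sub>0\<close> in auto)
qed

end
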